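(* Let $S_n=X_1+\cdots+X_n$ denote the partial sum for an i.i.d. sequence of discrete random variables $X_i$ (i.e. taking values in $\{0,1,2,\ldots\}$) with mean $\mathrm{E}(X_1)=m>0$ and dispersion $\mathrm{S}(X_1)=\gamma>0$. Define the translated standardized variable $Z_n(\mu)$ for $\mu\ge\gamma$ by $$Z_n(\mu)=n^{-1/2}\cdot\left[S_n\ominus\left(nm-n^{1/2}\mu\right)\right].$$ Then $Z_n(\mu)$ converges in distribution to the Hermite distribution $\mathrm{PT}_0(\mu,\gamma)$ as $n\to\infty$.
   Context: The factorial cumulant generating function (FCGF) of a random variable $X$ is $C(t)=C(t;X)=\log\mathrm{E}[(1+t)^X]$ for $t>-1$, with effective domain $\mathrm{dom}(C)=\{t>-1:C(t)<\infty\}$. FCGFs are always assumed to satisfy $\mathrm{int}(\mathrm{dom}(C))\neq\emptyset$, in which case $C$ characterizes the distribution of $X$; equalities between FCGFs are understood to hold in a neighbourhood of zero. When $0\in\mathrm{int}(\mathrm{dom}(C))$, the first two factorial cumulants are the mean $\mathrm{E}(X)=\dot C(0;X)$ and the dispersion $\mathrm{S}(X)=\ddot C(0;X)=\mathrm{Var}(X)-\mathrm{E}(X)$. Dilation: for $c>0$, $c\cdot X$ denotes a random variable (determined in distribution) with FCGF $C(t;c\cdot X)=C(ct;X)$, for those $c$ such that the right-hand side is an FCGF. For discrete $X$ and $0<c<1$ the dilation is binomial thinning: $c\cdot X$ is distributed as $\sum_{i=1}^X N_i$ with $N_i$ i.i.d. Bernoulli($c$), independent of $X$. Poisson subtraction: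 $X\ominus\mu$ denotes a random variable with FCGF $C(t;X\ominus\mu)=C(t;X)-\mu t$, for values $\mu\geq 0$ such that the right-hand side is an FCGF. The Hermite distribution $\mathrm{PT}_0(\mu,\gamma)$, with $0<\gamma\le\mu$, is the distribution with FCGF $C(t)=\frac{\gamma}{2}t^2+\mu t$; it has mean $\mu$ and dispersion $\gamma$. *)

theory Defs
  imports "HOL-Probability.Probability"
begin

text \<open>
  The factorial cumulant generating function \<open>log E[(1 + t)\<^sup>X]\<close>, meant for \<open>t > -1\<close>, with the
  value infinity where the expectation diverges.  On a probability space the expectation is
  positive for \<open>t > -1\<close>, so the logarithm is never taken at zero.
\<close>

definition fcgf :: "'a measure \<Rightarrow> ('a \<Rightarrow> real) \<Rightarrow> real \<Rightarrow> ereal" where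
  "fcgf M X t =
     (let E = (\<integral>\<^sup>+ \<omega>. ennreal ((1 + t) powr X \<omega>) \<partial>M)
      in if E = \<infinity> then \<infinity> else ereal (ln (enn2real E)))"

definition fcgf_dom :: "'a measure \<Rightarrow> ('a \<Rightarrow> real) \<Rightarrow> real set" where
  "fcgf_dom M X = {t. - 1 < t \<and> fcgf M X t < \<infinity>}"

text \<open>
  Equality between FCGFs is equality in a neighbourhood of zero, as extended real functions.
\<close>

definition has_fcgf :: "'a measure \<Rightarrow> ('a \<Rightarrow> real) \<Rightarrow> (real \<Rightarrow> ereal) \<Rightarrow> bool" where
  "has_fcgf M X C \<longleftrightarrow>
     interior (fcgf_dom M X) \<noteq> {} \<and> (\<forall>\<^sub>F t in nhds 0. fcgf M X t = C t)"

text \<open>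
  Dilation and Poisson subtraction are determined in distribution by their action on FCGFs:
  a random variable is a version of \<open>c \<cdot> X\<close> if its FCGF is \<open>fcgf_dilate c (fcgf M X)\<close>, and a
  version of \<open>X \<ominus> \<mu>\<close> if its FCGF is \<open>fcgf_poisson_minus (fcgf M X) \<mu>\<close>.
  In a composition such as \<open>c \<cdot> (X \<ominus> \<mu>)\<close> only the composed function has to be an FCGF: for \<open>c < 1\<close> the
  intermediate \<open>X \<ominus> \<mu>\<close> may fail to exist as a random variable while the dilated one exists.
\<close>

definition fcgf_dilate :: "real \<Rightarrow> (real \<Rightarrow> ereal) \<Rightarrow> real \<Rightarrow> ereal" where
  "fcgf_dilate c C = (\<lambda>t. C (c * t))"

definition fcgf_poisson_minus :: "(real \<Rightarrow> ereal) \<Rightarrow> real \<Rightarrow> real \<Rightarrow> ereal" where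
  "fcgf_poisson_minus C \<mu> = (\<lambda>t. C t - ereal (\<mu> * t))"

text \<open>
  The dispersion \<open>S(X) = Var(X) - E(X)\<close>, for square integrable \<open>X\<close>.  When zero is interior to
  the effective domain it is the second factorial cumulant; see \<open>factorial_cumulants\<close> below.
\<close>

definition dispersion :: "'a measure \<Rightarrow> ('a \<Rightarrow> real) \<Rightarrow> real" where
  "dispersion M X = prob_space.variance M X - prob_space.expectation M X"

definition hermite_distr :: "real \<Rightarrow> real \<Rightarrow> real measure" where
  "hermite_distr \<mu> \<gamma> =
     (THE H. real_distribution H \<and>
        has_fcgf H (\<lambda>x. x) (\<lambda>t. ereal (\<gamma> / 2 * t\<^sup>2 + \<mu> * t)))"

lemma (in prob_space) nat_rv_pmf:
  fixes X :: "'a \<Rightarrow> nat"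
  assumes [measurable]: "random_variable (count_space UNIV) X"
  obtains p :: "nat pmf" where "distr M (count_space UNIV) X = measure_pmf p"
proof -
  interpret D: prob_space "distr M (count_space UNIV) X"
    by (rule prob_space_distr) simp
  have "AE x in distr M (count_space UNIV) X. measure (distr M (count_space UNIV) X) {x} \<noteq> 0"
    by (subst D.AE_support_countable) (auto intro!: exI[of _ UNIV])
  then have "measure_pmf (Abs_pmf (distr M (count_space UNIV) X)) = distr M (count_space UNIV) X"
    by (intro Abs_pmf_inverse) (auto simp: D.prob_space_axioms)
  with that show thesis by metis
qed

lemma (in prob_space) factorial_cumulants:
  fixes X :: "'a \<Rightarrow> nat"
  assumes X[measurable]: "random_variable (count_space UNIV) X"
    and dom: "0 \<in> interior (fcgf_dom M (\<lambda>\<omega>. real (X \<omega>)))"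
  defines "C \<equiv> \<lambda>t. real_of_ereal (fcgf M (\<lambda>\<omega>. real (X \<omega>)) t)"
  shows "integrable M (\<lambda>\<omega>. (real (X \<omega>))\<^sup>2)"
    and "deriv C 0 = expectation (\<lambda>\<omega>. real (X \<omega>))"
    and "deriv (deriv C) 0 = dispersion M (\<lambda>\<omega>. real (X \<omega>))"
proof -
  obtain p where p: "distr M (count_space UNIV) X = measure_pmf p"
    using nat_rv_pmf[OF X] .
  define a where "a = pmf p"
  have a0: "a k \<ge> 0" for k by (simp add: a_def)
  have nn: "(\<integral>\<^sup>+ \<omega>. ennreal (f (X \<omega>)) \<partial>M) = (\<Sum>k. ennreal (a k * f k))"
    if "\<And>k. f k \<ge> 0" for f :: "nat \<Rightarrow> real"
  proof -
    have "(\<integral>\<^sup>+ \<omega>. ennreal (f (X \<omega>)) \<partial>M) = (\<integral>\<^sup>+ k. ennreal (f k) \<partial>measure_pmf p)"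
      unfolding p[symmetric] by (subst nn_integral_distr) auto
    also have "\<dots> = (\<Sum>k. ennreal (a k) * ennreal (f k))"
      by (simp add: nn_integral_measure_pmf nn_integral_count_space_nat a_def)
    finally show ?thesis using that a0 by (simp add: ennreal_mult)
  qed
  have expct: "integrable M (\<lambda>\<omega>. f (X \<omega>)) \<and> expectation (\<lambda>\<omega>. f (X \<omega>)) = S"
    if "\<And>k. f k \<ge> 0" "(\<lambda>k. a k * f k) sums S" for f :: "nat \<Rightarrow> real" and S
  proof -
    have S: "S \<ge> 0" using that a0 by (auto intro!: sums_le[OF _ sums_zero that(2)])
    have "(\<integral>\<^sup>+ \<omega>. ennreal (f (X \<omega>)) \<partial>M) = ennreal S"
      using that a0 by (subst nn) (auto intro!: suminf_ennreal_eq)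
    then show ?thesis
      using S that(1) by (subst integrable_iff_bounded)
        (auto simp: integral_eq_nn_integral)
  qed
  obtain e where e: "e > 0" "cball 0 e \<subseteq> fcgf_dom M (\<lambda>\<omega>. real (X \<omega>))"
    using dom by (meson mem_interior_cball)
  define r where "r = 1 + e"
  have r: "r > 1" using e by (simp add: r_def)
  have powr_eq: "(1 + t) powr real k = (1 + t) ^ k" if "t > -1" for t and k :: nat
    using that by (simp add: powr_realpow)
  have "e \<in> fcgf_dom M (\<lambda>\<omega>. real (X \<omega>))" using e by auto
  then have "(\<integral>\<^sup>+ \<omega>. ennreal (r powr real (X \<omega>)) \<partial>M) \<noteq> \<infinity>"
    by (auto simp: fcgf_dom_def fcgf_def Let_def r_def split: if_splits)
  then have "(\<Sum>k. ennreal (a k * r ^ k)) \<noteq> \<infinity>"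
    using nn[of "\<lambda>k. r powr real k"] powr_eq[of e] e by (simp add: r_def)
  then have sm: "summable (\<lambda>k. a k * r ^ k)"
    using a0 r by (intro summable_suminf_not_top) auto
  define G where "G = (\<lambda>s. \<Sum>k. a k * s ^ k)"
  define G1 where "G1 = (\<lambda>s. \<Sum>k. diffs a k * s ^ k)"
  define G2 where "G2 = (\<lambda>s. \<Sum>k. diffs (diffs a) k * s ^ k)"
  have sm0: "summable (\<lambda>k. a k * s ^ k)" if "\<bar>s\<bar> < r" for s
    using powser_inside[OF sm, of s] that r by simp
  have sm1: "summable (\<lambda>k. diffs a k * s ^ k)" if "\<bar>s\<bar> < r" for s
    using termdiff_converges[of s r a] sm0 that by simp
  have sm2: "summable (\<lambda>k. diffs (diffs a) k * s ^ k)" if "\<bar>s\<bar> < r" for s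
    using termdiff_converges[of s r "diffs a"] sm1 that by simp
  have dG: "(G has_real_derivative G1 s) (at s)" if "\<bar>s\<bar> < r" for s
    unfolding G_def G1_def using that r by (intro termdiffs_strong[OF sm]) auto
  have dG1: "(G1 has_real_derivative G2 s) (at s)" if "\<bar>s\<bar> < r" for s
    unfolding G1_def G2_def using that sm1
    by (intro termdiffs_strong'[of r]) auto
  have G_sums: "(\<lambda>k. a k * s ^ k) sums G s" if "\<bar>s\<bar> < r" for s
    using sm0[OF that] by (simp add: G_def summable_sums)
  have E0: "G 1 = 1"
    using expct[of "\<lambda>_. 1" "G 1"] G_sums[of 1] r by (simp add: prob_space)
  have "(\<lambda>k. a (Suc k) * real (Suc k)) sums G1 1"
    using sm1[of 1] r summable_sums by (fastforce simp: G1_def diffs_def mult.commute)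
  then have S1: "(\<lambda>k. a k * real k) sums G1 1"
    using sums_Suc[of "\<lambda>k. a k * real k" "G1 1"] by simp
  have "(\<lambda>k. a (Suc (Suc k)) * (real (Suc (Suc k)) * real (Suc k))) sums G2 1"
    using sm2[of 1] r summable_sums
    by (fastforce simp: G2_def diffs_def algebra_simps)
  then have "(\<lambda>k. a (Suc k) * (real (Suc k) * real k)) sums G2 1"
    using sums_Suc[of "\<lambda>k. a (Suc k) * (real (Suc k) * real k)" "G2 1"] by simp
  then have S2: "(\<lambda>k. a k * (real k * (real k - 1))) sums G2 1"
    using sums_Suc[of "\<lambda>k. a k * (real k * (real k - 1))" "G2 1"] by simp
  have S3: "(\<lambda>k. a k * (real k)\<^sup>2) sums (G2 1 + G1 1)"
    using sums_add[OF S2 S1] by (simp add: algebra_simps power2_eq_square)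
  note E1 = expct[of real, OF _ S1, simplified]
  note E2 = expct[of "\<lambda>k. (real k)\<^sup>2", OF _ S3, simplified]
  show "integrable M (\<lambda>\<omega>. (real (X \<omega>))\<^sup>2)" using E2 by simp
  have disp: "dispersion M (\<lambda>\<omega>. real (X \<omega>)) = G2 1 - (G1 1)\<^sup>2"
    using E1 E2 variance_eq[of "\<lambda>\<omega>. real (X \<omega>)"] by (simp add: dispersion_def)
  have C_eq: "C t = ln (G (1 + t))" if "t \<in> {-1<..<e}" for t
  proof -
    have s: "\<bar>1 + t\<bar> < r" using that by (auto simp: r_def)
    have "(\<integral>\<^sup>+ \<omega>. ennreal ((1 + t) powr real (X \<omega>)) \<partial>M) = (\<Sum>k. ennreal (a k * (1 + t) ^ k))"
      using nn[of "\<lambda>k. (1 + t) powr real k"] that by (simp add: powr_eq)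
    also have "\<dots> = ennreal (G (1 + t))"
      using that a0 by (intro suminf_ennreal_eq G_sums s) auto
    finally have *: "(\<integral>\<^sup>+ \<omega>. ennreal ((1 + t) powr real (X \<omega>)) \<partial>M) = ennreal (G (1 + t))" .
    have "G (1 + t) \<ge> 0"
      using that a0 by (auto intro!: sums_le[OF _ sums_zero G_sums[OF s]])
    then show ?thesis
      unfolding C_def fcgf_def Let_def * by simp
  qed
  have Gpos: "G (1 + t) > 0" if "t \<in> {-1<..<e}" for t
  proof -
    have s: "\<bar>1 + t\<bar> < r" using that by (auto simp: r_def)
    obtain k where "a k \<noteq> 0"
      using set_pmf_not_empty[of p] by (auto simp: a_def set_pmf_iff)
    then have "0 < a k * (1 + t) ^ k" using a0[of k] that by auto
    also have "\<dots> \<le> G (1 + t)"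
      unfolding G_def using that a0 sum_le_suminf[OF sm0[OF s], of "{k}"] by simp
    finally show ?thesis .
  qed
  have dC: "(C has_real_derivative G1 (1 + t) / G (1 + t)) (at t)" if t: "t \<in> {-1<..<e}" for t
  proof -
    have s: "\<bar>1 + t\<bar> < r" using that by (auto simp: r_def)
    have "((\<lambda>t. ln (G (1 + t))) has_real_derivative G1 (1 + t) / G (1 + t)) (at t)"
      using Gpos[OF t] dG[OF s] DERIV_shift[of G "G1 (1 + t)" t 1]
      by (auto intro!: derivative_eq_intros simp: add.commute)
    then show ?thesis
      by (rule has_field_derivative_transform_within_open[of _ _ _ "{-1<..<e}"])
         (use t C_eq in auto)
  qed
  show "deriv C 0 = expectation (\<lambda>\<omega>. real (X \<omega>))"
    using DERIV_imp_deriv[OF dC[of 0]] e E0 E1 by simp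
  have d: "((\<lambda>t. G1 (1 + t) / G (1 + t)) has_real_derivative G2 1 - (G1 1)\<^sup>2) (at 0)"
  proof -
    have "((\<lambda>t. G1 (1 + t)) has_real_derivative G2 1) (at 0)"
      using dG1[of 1] DERIV_shift[of G1 "G2 1" 0 1] r
      by (simp add: add.commute)
    moreover have "((\<lambda>t. G (1 + t)) has_real_derivative G1 1) (at 0)"
      using dG[of 1] DERIV_shift[of G "G1 1" 0 1] r
      by (simp add: add.commute)
    ultimately show ?thesis
      using E0 DERIV_divide[of "\<lambda>t. G1 (1 + t)" "G2 1" 0 UNIV "\<lambda>t. G (1 + t)" "G1 1"]
      by (simp add: power2_eq_square)
  qed
  have "(deriv C has_real_derivative G2 1 - (G1 1)\<^sup>2) (at 0)"
    by (rule has_field_derivative_transform_within_open[OF d, of "{-1<..<e}"])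
       (use e dC in \<open>auto intro!: DERIV_imp_deriv[symmetric]\<close>)
  then show "deriv (deriv C) 0 = dispersion M (\<lambda>\<omega>. real (X \<omega>))"
    by (simp add: DERIV_imp_deriv disp)
qed

end

theory Submission
  imports Defs "HOL-Complex_Analysis.Conformal_Mappings" "HOL-Real_Asymp.Real_Asymp"
begin

text \<open>
  The FCGF of \<open>Z\<^sub>n(\<mu>)\<close> is \<open>n C(t / \<surd>n) - (\<surd>n m - \<mu>) t\<close>, where \<open>C\<close> is the FCGF of \<open>X\<^sub>1\<close>.  As
  \<open>C(t) = m t + \<gamma> t\<^sup>2 / 2 + o(t\<^sup>2)\<close> for \<open>t\<close> increasing to zero, the subtraction cancels the term of order \<open>\<surd>n\<close>, and the limit is
  the Hermite FCGF \<open>\<gamma> t\<^sup>2 / 2 + \<mu> t\<close>.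

  Pointwise convergence of FCGFs is not immediately useful: only second moments are assumed, so the
  FCGFs may be infinite for every \<open>t > 0\<close>; the neighbourhood of zero on which the FCGF of \<open>Z\<^sub>n(\<mu>)\<close> is
  prescribed may shrink with \<open>n\<close>; and \<open>Z\<^sub>n(\<mu>)\<close> may take arbitrary real values.  The
  argument therefore passes to characteristic functions.  Formally, the characteristic function at
  \<open>u\<close> is \<open>exp\<close> of the FCGF at \<open>t = e\<^sup>i\<^sup>u - 1\<close>, a boundary point of the disk \<open>|1 + t| < 1\<close>.

  This is made rigorous in \<open>char_distr_of_fcgf\<close>.  Let \<open>\<Phi>\<close> be holomorphic on the open unit disk and
  continuous on the closed one, with \<open>\<Phi>(1 + t) = exp (C(t; Z))\<close> for \<open>t\<close> in some interval
  \<open>(-\<delta>, 0)\<close>.  The Laplace transform \<open>E[e\<^sup>q\<^sup>Z]\<close> is holomorphic in a strip to the left of the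
  imaginary axis and continuous up to that axis.  The same holds for \<open>\<Phi>(e\<^sup>q)\<close>, and the two agree on a
  real interval, hence on the strip, hence on the axis.  So the FCGF to the left of zero
  determines the characteristic function.

  Two uses of this are made.  With \<open>\<Phi>\<close> the exponential of a quadratic polynomial it gives uniqueness
  of the Hermite distribution; existence comes from a sum of independent Poisson variables.  With
  \<open>\<Phi>\<close> built from the probability generating function \<open>G\<close> of \<open>X\<^sub>1\<close>, the characteristic function
  of \<open>Z\<^sub>n(\<mu>)\<close> becomes \<open>(G(1 + z / \<surd>n) exp (- m z / \<surd>n))\<^sup>n exp (\<mu> z)\<close> with \<open>z = e\<^sup>i\<^sup>u - 1\<close>.  A second-order Taylor
  expansion of \<open>G\<close> at \<open>1\<close>, valid inside the closed disk because \<open>X\<^sub>1\<close> is square integrable, gives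
  the limit (\<open>standardized_pgf_tendsto\<close>), and Levy's continuity theorem concludes.
\<close>

section \<open>The bilateral Laplace transform in a strip\<close>

lemma norm_exp_times_le:
  fixes q :: complex and x :: real
  assumes "a \<le> Re q" "Re q \<le> b"
  shows "norm (exp (q * of_real x)) \<le> exp (a * x) + exp (b * x)"
proof (cases "x \<ge> 0")
  case True
  then have "exp (Re q * x) \<le> exp (b * x)" using assms by (simp add: mult_right_mono)
  then show ?thesis by (simp add: add_increasing)
next
  case False
  then have "exp (Re q * x) \<le> exp (a * x)" using assms by (simp add: mult_right_mono_neg)
  then show ?thesis by (simp add: add_increasing2)
qed

definition laplace :: "'a measure \<Rightarrow> ('a \<Rightarrow> real) \<Rightarrow> complex \<Rightarrow> complex" where
  "laplace M X q = (\<integral>\<omega>. exp (q * of_real (X \<omega>)) \<partial>M)"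

lemma integrable_exp_strip:
  fixes X :: "'a \<Rightarrow> real" and q :: complex
  assumes [measurable]: "X \<in> borel_measurable M"
    and "integrable M (\<lambda>\<omega>. exp (a * X \<omega>))" "integrable M (\<lambda>\<omega>. exp (b * X \<omega>))"
    and "a \<le> Re q" "Re q \<le> b"
  shows "integrable M (\<lambda>\<omega>. exp (q * of_real (X \<omega>)))"
proof (rule Bochner_Integration.integrable_bound)
  show "integrable M (\<lambda>\<omega>. exp (a * X \<omega>) + exp (b * X \<omega>))"
    using assms by simp
  show "AE \<omega> in M. norm (exp (q * of_real (X \<omega>))) \<le> norm (exp (a * X \<omega>) + exp (b * X \<omega>))"
    using norm_exp_times_le[OF assms(4,5)] by (auto intro: order_trans)
qed simp

lemma continuous_on_laplace:
  fixes X :: "'a \<Rightarrow> real"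
  assumes [measurable]: "X \<in> borel_measurable M"
    and "integrable M (\<lambda>\<omega>. exp (a * X \<omega>))" "integrable M (\<lambda>\<omega>. exp (b * X \<omega>))"
  shows "continuous_on {q. a \<le> Re q \<and> Re q \<le> b} (laplace M X)"
  unfolding continuous_on_sequentially
proof (intro ballI allI impI, elim conjE)
  fix q and S :: "nat \<Rightarrow> complex"
  assume S: "\<forall>n. S n \<in> {q. a \<le> Re q \<and> Re q \<le> b}" "S \<longlonglongrightarrow> q"
  show "(laplace M X \<circ> S) \<longlonglongrightarrow> laplace M X q"
    unfolding laplace_def comp_def
  proof (rule integral_dominated_convergence[where w = "\<lambda>\<omega>. exp (a * X \<omega>) + exp (b * X \<omega>)"])
    show "AE \<omega> in M. (\<lambda>i. exp (S i * of_real (X \<omega>))) \<longlonglongrightarrow> exp (q * of_real (X \<omega>))"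
      using S(2) by (auto intro!: tendsto_intros)
    show "AE \<omega> in M. norm (exp (S i * of_real (X \<omega>))) \<le> exp (a * X \<omega>) + exp (b * X \<omega>)" for i
      using S(1) norm_exp_times_le[of a "S i" b] by auto
  qed (use assms in auto)
qed

text \<open>
  This dominates the difference quotients of \<open>q \<mapsto> e\<^sup>q\<^sup>x\<close>.  The factor \<open>|x|\<close> that
  differentiation produces costs one \<open>e\<^sup>\<delta>\<^sup>|\<^sup>x\<^sup>|\<close>, the increment of \<open>q\<close> another, so twice
  the radius \<open>\<delta>\<close> appears in the exponents.
\<close>

lemma norm_exp_diff_quotient_le:
  fixes h :: complex and x :: real
  assumes "h \<noteq> 0" "norm h \<le> \<delta>" "\<delta> > 0"
  shows "norm ((exp (h * of_real x) - 1) / h) \<le> (exp (2 * \<delta> * x) + exp (- 2 * \<delta> * x)) / \<delta>"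
proof -
  have "norm (exp (h * of_real x) - 1) \<le> exp (norm (h * of_real x)) * norm (h * of_real x)"
    using Taylor_exp_field[of "h * of_real x" 0] by simp
  then have "norm ((exp (h * of_real x) - 1) / h) \<le> exp (norm h * \<bar>x\<bar>) * \<bar>x\<bar>"
    using assms(1) by (simp add: norm_divide norm_mult field_simps)
  also have "\<dots> \<le> exp (\<delta> * \<bar>x\<bar>) * (exp (\<delta> * \<bar>x\<bar>) / \<delta>)"
  proof (rule mult_mono)
    have "\<delta> * \<bar>x\<bar> \<le> exp (\<delta> * \<bar>x\<bar>)"
      using exp_ge_add_one_self[of "\<delta> * \<bar>x\<bar>"] by linarith
    then show "\<bar>x\<bar> \<le> exp (\<delta> * \<bar>x\<bar>) / \<delta>" using assms(3) by (simp add: field_simps)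
  qed (use assms in \<open>auto intro: mult_right_mono\<close>)
  also have "\<dots> = exp (2 * \<delta> * \<bar>x\<bar>) / \<delta>"
    by (simp add: exp_add[symmetric])
  also have "\<dots> \<le> (exp (2 * \<delta> * x) + exp (- 2 * \<delta> * x)) / \<delta>"
    using assms(3) by (intro divide_right_mono) (auto simp: abs_if)
  finally show ?thesis .
qed

text \<open>
  Differentiation under the integral sign.  A disk of radius \<open>\<delta>\<close> around \<open>q\<close> is chosen so small that
  the dominating exponentials still have exponents in the range between \<open>a\<close> and \<open>b\<close>.
\<close>

lemma holomorphic_on_laplace:
  fixes X :: "'a \<Rightarrow> real"
  assumes [measurable]: "X \<in> borel_measurable M"
    and int: "integrable M (\<lambda>\<omega>. exp (a * X \<omega>))" "integrable M (\<lambda>\<omega>. exp (b * X \<omega>))"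
  shows "laplace M X holomorphic_on {q. a < Re q \<and> Re q < b}"
proof -
  have "(laplace M X has_field_derivative (\<integral>\<omega>. exp (q * of_real (X \<omega>)) * of_real (X \<omega>) \<partial>M)) (at q)"
    if q: "a < Re q" "Re q < b" for q
  proof -
    define \<delta> where "\<delta> = min (Re q - a) (b - Re q) / 2"
    have \<delta>: "\<delta> > 0" "Re q + 2 * \<delta> \<le> b" "a \<le> Re q - 2 * \<delta>"
      using q by (auto simp: \<delta>_def min_def)
    define w where "w x = (exp ((Re q + 2 * \<delta>) * x) + exp ((Re q - 2 * \<delta>) * x)) / \<delta>" for x
    have strip: "integrable M (\<lambda>\<omega>. exp (p * of_real (X \<omega>)))" if "a \<le> Re p" "Re p \<le> b" for p :: complex
      using integrable_exp_strip[OF _ int] that by simp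
    have real_strip: "integrable M (\<lambda>\<omega>. exp (x * X \<omega>))" if "a \<le> x" "x \<le> b" for x :: real
      using integrable_norm[OF strip[of "of_real x"]] that by simp
    have "((\<lambda>h. (laplace M X (q + h) - laplace M X q) / h) \<longlongrightarrow>
            (\<integral>\<omega>. exp (q * of_real (X \<omega>)) * of_real (X \<omega>) \<partial>M)) (at 0 within ball 0 \<delta>)"
      unfolding tendsto_at_iff_sequentially
    proof (intro allI impI)
      fix S :: "nat \<Rightarrow> complex"
      assume S: "\<forall>i. S i \<in> ball 0 \<delta> - {0}" "S \<longlonglongrightarrow> 0"
      have S': "S i \<noteq> 0" "norm (S i) \<le> \<delta>" for i using S(1)[rule_format, of i] by auto
      have "a \<le> Re (q + S i) \<and> Re (q + S i) \<le> b" for i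
        using abs_Re_le_cmod[of "S i"] S'(2)[of i] \<delta> by (auto simp: abs_if split: if_splits)
      then have int_q: "integrable M (\<lambda>\<omega>. exp ((q + S i) * of_real (X \<omega>)))"
          "integrable M (\<lambda>\<omega>. exp (q * of_real (X \<omega>)))" for i
        using strip[of q] strip[of "q + S i"] q by auto
      have eq: "(laplace M X (q + S i) - laplace M X q) / S i =
          (\<integral>\<omega>. exp (q * of_real (X \<omega>)) * ((exp (S i * of_real (X \<omega>)) - 1) / S i) \<partial>M)" for i
      proof -
        have "(laplace M X (q + S i) - laplace M X q) / S i =
            (\<integral>\<omega>. (exp ((q + S i) * of_real (X \<omega>)) - exp (q * of_real (X \<omega>))) / S i \<partial>M)"
          unfolding laplace_def Bochner_Integration.integral_diff[OF int_q, symmetric]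
          by (rule integral_divide_zero[symmetric])
        also have "\<dots> = (\<integral>\<omega>. exp (q * of_real (X \<omega>)) * ((exp (S i * of_real (X \<omega>)) - 1) / S i) \<partial>M)"
          by (intro Bochner_Integration.integral_cong) (auto simp: distrib_right right_diff_distrib exp_add)
        finally show ?thesis .
      qed
      show "((\<lambda>h. (laplace M X (q + h) - laplace M X q) / h) \<circ> S) \<longlonglongrightarrow>
            (\<integral>\<omega>. exp (q * of_real (X \<omega>)) * of_real (X \<omega>) \<partial>M)"
        unfolding comp_def eq
      proof (rule integral_dominated_convergence[where w = "\<lambda>\<omega>. w (X \<omega>)"])
        show "integrable M (\<lambda>\<omega>. w (X \<omega>))"
          unfolding w_def using \<delta> q real_strip[of "Re q + 2 * \<delta>"] real_strip[of "Re q - 2 * \<delta>"] by simp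
        have lim: "(\<lambda>i. (exp (S i * of_real x) - 1) / S i) \<longlonglongrightarrow> of_real x" for x
        proof -
          have "((\<lambda>h::complex. exp (h * of_real x)) has_field_derivative of_real x) (at 0)"
            by (auto intro!: derivative_eq_intros)
          then have "((\<lambda>h. (exp (h * of_real x) - 1) / h) \<longlongrightarrow> of_real x) (at (0::complex))"
            by (simp add: DERIV_def)
          then show ?thesis
            by (rule filterlim_compose) (use S(2) S'(1) in \<open>auto simp: filterlim_at\<close>)
        qed
        show "AE \<omega> in M. (\<lambda>i. exp (q * of_real (X \<omega>)) * ((exp (S i * of_real (X \<omega>)) - 1) / S i))
              \<longlonglongrightarrow> exp (q * of_real (X \<omega>)) * of_real (X \<omega>)"
          by (intro AE_I2 tendsto_mult_left lim)
        have "norm (exp (q * of_real x) * ((exp (S i * of_real x) - 1) / S i)) \<le> w x" for i x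
        proof -
          have "norm (exp (q * of_real x) * ((exp (S i * of_real x) - 1) / S i))
              \<le> exp (Re q * x) * ((exp (2 * \<delta> * x) + exp (- 2 * \<delta> * x)) / \<delta>)"
            unfolding norm_mult using norm_exp_diff_quotient_le[OF S'(1)[of i] S'(2)[of i] \<delta>(1), of x]
            by (intro mult_mono) auto
          also have "\<dots> = w x"
            by (simp add: w_def distrib_left distrib_right left_diff_distrib add_divide_distrib flip: exp_add)
          finally show ?thesis .
        qed
        then show "AE \<omega> in M. norm (exp (q * of_real (X \<omega>)) * ((exp (S i * of_real (X \<omega>)) - 1) / S i))
            \<le> w (X \<omega>)" for i
          by auto
      qed auto
    qed
    then show ?thesis
      using \<delta>(1) by (simp add: DERIV_def at_within_open[of 0 "ball 0 \<delta>"])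
  qed
  then show ?thesis
    unfolding holomorphic_on_def field_differentiable_def by (blast intro: has_field_derivative_at_within)
qed

section \<open>From factorial cumulants to characteristic functions\<close>

lemma fcgf_eqI:
  assumes "(\<integral>\<^sup>+ \<omega>. ennreal ((1 + t) powr X \<omega>) \<partial>M) = ennreal g" "g \<ge> 0"
  shows "fcgf M X t = ereal (ln g)"
  using assms by (simp add: fcgf_def)

lemma (in prob_space) expectation_powr_of_fcgf:
  fixes X :: "'a \<Rightarrow> real"
  assumes [measurable]: "X \<in> borel_measurable M"
    and t: "t > -1" and c: "fcgf M X t = ereal c"
  shows "integrable M (\<lambda>\<omega>. (1 + t) powr X \<omega>)"
    and "expectation (\<lambda>\<omega>. (1 + t) powr X \<omega>) = exp c"
proof -
  define E where "E = (\<integral>\<^sup>+ \<omega>. ennreal ((1 + t) powr X \<omega>) \<partial>M)"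
  have fin: "E \<noteq> \<infinity>" and lnE: "ln (enn2real E) = c"
    using c by (auto simp: fcgf_def Let_def E_def split: if_splits)
  show int: "integrable M (\<lambda>\<omega>. (1 + t) powr X \<omega>)"
    using fin by (intro integrableI_bounded) (auto simp: E_def less_top)
  have E: "expectation (\<lambda>\<omega>. (1 + t) powr X \<omega>) = enn2real E"
    unfolding E_def by (intro integral_eq_nn_integral) auto
  have "expectation (\<lambda>\<omega>. (1 + t) powr X \<omega>) > 0"
    using int t integral_less_AE_space[of "\<lambda>_. 0" "\<lambda>\<omega>. (1 + t) powr X \<omega>"] emeasure_space_1
    by simp
  then show "expectation (\<lambda>\<omega>. (1 + t) powr X \<omega>) = exp c"
    using E lnE by (metis exp_ln)
qed

text \<open>
  With \<open>1 + t = e\<^sup>x\<close> the hypothesis says that the Laplace transform and \<open>\<Phi> \<circ> exp\<close> agree on an interval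
  of the negative real axis ending at zero.  The exponential maps the left half plane into the unit
  disk, so both are holomorphic in a strip there, and the identity theorem applies.
  Continuity up to the imaginary axis then yields the characteristic function.
\<close>

lemma char_distr_of_fcgf:
  fixes X :: "'a \<Rightarrow> real" and \<Phi> :: "complex \<Rightarrow> complex"
  assumes M: "prob_space M" and X[measurable]: "X \<in> borel_measurable M"
    and fc: "\<forall>\<^sub>F t in at_left 0. \<exists>c. fcgf M X t = ereal c \<and> of_real (exp c) = \<Phi> (of_real (1 + t))"
    and hol: "\<Phi> holomorphic_on ball 0 1" and cont: "continuous_on (cball 0 1) \<Phi>"
  shows "char (distr M borel X) u = \<Phi> (iexp u)"
proof -
  interpret prob_space M by fact
  obtain b where b: "b < 0"
    and c: "\<And>t. b < t \<Longrightarrow> t < 0 \<Longrightarrow> \<exists>c. fcgf M X t = ereal c \<and> of_real (exp c) = \<Phi> (of_real (1 + t))"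
    using fc unfolding eventually_at_left_field by blast
  \<comment> \<open>Halving ensures \<open>t > b\<close> and \<open>1 + t > 0\<close> for \<open>t = e\<^sup>x - 1\<close> down to the left end \<open>x = a\<close> of the strip.\<close>
  define a where "a = ln (1 + max b (-1) / 2)"
  have mb: "-1 \<le> max b (-1)" "max b (-1) < 0" "b \<le> max b (-1)"
    using b by auto
  have a: "a < 0" and ea: "exp a = 1 + max b (-1) / 2"
    using mb unfolding a_def by (auto intro!: ln_less_zero)
  have real_side: "integrable M (\<lambda>\<omega>. exp (x * X \<omega>))"
      "laplace M X (of_real x) = \<Phi> (exp (of_real x))" if x: "a \<le> x" "x < 0" for x
  proof -
    have "exp a \<le> exp x" using x by simp
    moreover have "exp x < 1" using x by simp
    ultimately have "b < exp x - 1" "exp x - 1 < 0" "-1 < exp x - 1"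
      using ea mb by linarith+
    with c obtain c where c: "fcgf M X (exp x - 1) = ereal c" "of_real (exp c) = \<Phi> (of_real (exp x))"
      by force
    have powr: "(1 + (exp x - 1)) powr y = exp (x * y)" for y
      by (simp add: powr_def mult.commute)
    note E = expectation_powr_of_fcgf[OF X \<open>-1 < exp x - 1\<close> c(1), unfolded powr]
    show "integrable M (\<lambda>\<omega>. exp (x * X \<omega>))" by (fact E)
    have "laplace M X (of_real x) = (\<integral>\<omega>. of_real (exp (x * X \<omega>)) \<partial>M)"
      by (simp add: laplace_def exp_of_real flip: of_real_mult)
    also have "\<dots> = of_real (exp c)"
      by (simp only: integral_complex_of_real E)
    finally show "laplace M X (of_real x) = \<Phi> (exp (of_real x))"
      using c(2) by (simp add: exp_of_real)
  qed
  note int_a = real_side(1)[of a, OF order_refl a]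
  have int_0: "integrable M (\<lambda>\<omega>. exp (0 * X \<omega>))" by simp
  have exp_disk: "exp q \<in> cball 0 1" if "Re q \<le> 0" for q :: complex
    using that by simp
  have cont\<Phi>: "continuous_on {q. a \<le> Re q \<and> Re q \<le> 0} (\<lambda>q. \<Phi> (exp q))"
    using exp_disk by (intro continuous_on_compose2[OF cont] continuous_intros) auto
  have hol\<Phi>: "(\<lambda>q. \<Phi> (exp q)) holomorphic_on {q. a < Re q \<and> Re q < 0}"
    using holomorphic_on_compose_gen[of exp _ \<Phi> "ball 0 1"] hol
    by (force simp: comp_def intro!: holomorphic_intros)
  have strip: "open {q. a < Re q \<and> Re q < 0}" "connected {q. a < Re q \<and> Re q < 0}"
    by (auto intro!: convex_connected convex_Int convex_halfspace_Re_lt convex_halfspace_Re_gt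
        open_Int open_halfspace_Re_lt open_halfspace_Re_gt simp: Collect_conj_eq)
  have interior: "laplace M X q = \<Phi> (exp q)" if q: "a < Re q" "Re q < 0" for q
  proof -
    have "laplace M X q - \<Phi> (exp q) = 0"
    proof (rule analytic_continuation[where f = "\<lambda>q. laplace M X q - \<Phi> (exp q)", OF _ strip])
      show "(\<lambda>q. laplace M X q - \<Phi> (exp q)) holomorphic_on {q. a < Re q \<and> Re q < 0}"
        using holomorphic_on_laplace[OF X int_a int_0] hol\<Phi> by (intro holomorphic_intros)
      show "of_real ` {a<..<0} \<subseteq> {q. a < Re q \<and> Re q < 0}" by auto
      show "complex_of_real (a / 2) \<in> {q. a < Re q \<and> Re q < 0}" using a by simp
      have "a / 2 islimpt {a<..<0}"
        using a by (intro open_imp_islimpt) auto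
      then show "complex_of_real (a / 2) islimpt of_real ` {a<..<0}"
        by (rule islimpt_isCont_image) (simp_all add: eventually_at_filter del: of_real_divide)
    qed (use q real_side in \<open>auto simp: less_imp_le\<close>)
    then show ?thesis by simp
  qed
  \<comment> \<open>Horizontal approach to the boundary point \<open>\<i> u\<close>; the shift by two keeps \<open>S n\<close> inside the strip.\<close>
  define S where "S n = Complex (a / real (n + 2)) u" for n
  have "(\<lambda>n. a / real (n + 2)) \<longlonglongrightarrow> 0"
    using LIMSEQ_ignore_initial_segment[OF lim_const_over_n[of a], of 2] by simp
  then have "S \<longlonglongrightarrow> Complex 0 u"
    unfolding S_def by (intro tendsto_Complex tendsto_const)
  then have S: "S \<longlonglongrightarrow> \<i> * of_real u"
    by (simp add: Complex_eq)
  have S_strip: "a < Re (S n)" "Re (S n) < 0" for n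
    using a mult_nonpos_nonneg[of a "real n"] by (auto simp: S_def field_simps)
  have "(\<lambda>n. laplace M X (S n)) \<longlonglongrightarrow> laplace M X (\<i> * of_real u)"
    using a S_strip
    by (intro continuous_on_tendsto_compose[OF continuous_on_laplace[OF X int_a int_0] S])
       (auto intro!: always_eventually less_imp_le)
  moreover have "(\<lambda>n. \<Phi> (exp (S n))) \<longlonglongrightarrow> \<Phi> (exp (\<i> * of_real u))"
    using a S_strip
    by (intro continuous_on_tendsto_compose[OF cont\<Phi> S]) (auto intro!: always_eventually less_imp_le)
  ultimately have "laplace M X (\<i> * of_real u) = \<Phi> (exp (\<i> * of_real u))"
    using interior[OF S_strip] by (auto intro: LIMSEQ_unique)
  then show ?thesis
    by (simp add: char_def laplace_def integral_distr mult_ac)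
qed

section \<open>The Hermite distribution\<close>

text \<open>Stated as an existence result so that rate zero, a point mass at zero, is covered as well.\<close>

lemma poisson_generating_function:
  fixes r :: real
  assumes "r \<ge> 0"
  shows "\<exists>p :: nat pmf. \<forall>s>0. (\<integral>\<^sup>+ k. ennreal (s ^ k) \<partial>measure_pmf p) = ennreal (exp (r * (s - 1)))"
proof (cases "r = 0")
  case True
  then show ?thesis by (intro exI[of _ "return_pmf 0"]) simp
next
  case False
  then have r: "r > 0" using assms by simp
  have "(\<integral>\<^sup>+ k. ennreal (s ^ k) \<partial>measure_pmf (poisson_pmf r)) = ennreal (exp (r * (s - 1)))"
    if s: "s > 0" for s :: real
  proof -
    have "(\<integral>\<^sup>+ k. ennreal (s ^ k) \<partial>measure_pmf (poisson_pmf r)) =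
        (\<Sum>k. ennreal (((r * s) ^ k /\<^sub>R fact k) * exp (- r)))"
      using r s by (simp add: nn_integral_measure_pmf nn_integral_count_space_nat
        power_mult_distrib divide_inverse mult_ac flip: ennreal_mult)
    also have "\<dots> = ennreal (exp (r * s) * exp (- r))"
      using r s by (intro suminf_ennreal_eq sums_mult2 exp_converges) auto
    finally show ?thesis by (simp add: right_diff_distrib exp_diff exp_minus divide_inverse)
  qed
  then show ?thesis by blast
qed

text \<open>
  The witness is the law of \<open>A + 2 B\<close> with independent \<open>A \<sim> Poisson(\<mu> - \<gamma>)\<close> and
  \<open>B \<sim> Poisson(\<gamma> / 2)\<close>: its FCGF is \<open>(\<mu> - \<gamma>) t + \<gamma> / 2 ((1 + t)\<^sup>2 - 1)\<close>.  The condition \<open>\<gamma> \<le> \<mu>\<close>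
  makes the first rate nonnegative.
\<close>

lemma hermite_distribution_exists:
  assumes "0 \<le> \<gamma>" "\<gamma> \<le> \<mu>"
  shows "\<exists>H. real_distribution H \<and> has_fcgf H (\<lambda>x. x) (\<lambda>t. ereal (\<gamma> / 2 * t\<^sup>2 + \<mu> * t))"
proof -
  obtain p q :: "nat pmf"
    where p: "\<And>s. s > 0 \<Longrightarrow> (\<integral>\<^sup>+ k. ennreal (s ^ k) \<partial>measure_pmf p) = ennreal (exp ((\<mu> - \<gamma>) * (s - 1)))"
      and q: "\<And>s. s > 0 \<Longrightarrow> (\<integral>\<^sup>+ k. ennreal (s ^ k) \<partial>measure_pmf q) = ennreal (exp (\<gamma> / 2 * (s - 1)))"
    using poisson_generating_function[of "\<mu> - \<gamma>"] poisson_generating_function[of "\<gamma> / 2"] assms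
    by auto
  define H where "H = distr (measure_pmf (pair_pmf p q)) borel (\<lambda>(a, b). real (a + 2 * b))"
  have real: "real_distribution H"
    unfolding H_def real_distribution_def real_distribution_axioms_def
    by (auto intro!: measure_pmf.prob_space_distr)
  have fcgf: "fcgf H (\<lambda>x. x) t = ereal (\<gamma> / 2 * t\<^sup>2 + \<mu> * t)" if t: "t > -1" for t
  proof -
    have "(\<integral>\<^sup>+ x. ennreal ((1 + t) powr x) \<partial>H) =
        (\<integral>\<^sup>+ a. \<integral>\<^sup>+ b. ennreal ((1 + t) ^ a) * ennreal (((1 + t)\<^sup>2) ^ b) \<partial>measure_pmf q \<partial>measure_pmf p)"
      using t unfolding H_def
      by (simp add: nn_integral_distr nn_integral_pair_pmf' case_prod_beta powr_realpow power_add
          power_mult flip: ennreal_mult of_nat_add)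
    also have "\<dots> = ennreal (exp ((\<mu> - \<gamma>) * t)) * ennreal (exp (\<gamma> / 2 * ((1 + t)\<^sup>2 - 1)))"
      using t by (simp add: nn_integral_cmult nn_integral_multc p q)
    also have "\<dots> = ennreal (exp (\<gamma> / 2 * t\<^sup>2 + \<mu> * t))"
      by (simp add: exp_add[symmetric] power2_eq_square algebra_simps flip: ennreal_mult)
    finally show ?thesis by (subst fcgf_eqI) auto
  qed
  then have "fcgf_dom H (\<lambda>x. x) = {-1<..}"
    by (auto simp: fcgf_dom_def)
  moreover have "\<forall>\<^sub>F t in nhds 0. fcgf H (\<lambda>x. x) t = ereal (\<gamma> / 2 * t\<^sup>2 + \<mu> * t)"
    using eventually_nhds_in_open[of "{-1<..}" "0::real"] by (auto elim!: eventually_mono simp: fcgf)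
  ultimately show ?thesis
    using real by (auto simp: has_fcgf_def interior_open intro!: exI[of _ H])
qed

definition hermite_pgf :: "real \<Rightarrow> real \<Rightarrow> complex \<Rightarrow> complex" where
  "hermite_pgf \<mu> \<gamma> w = exp (of_real (\<gamma> / 2) * (w - 1)\<^sup>2 + of_real \<mu> * (w - 1))"

text \<open>Since the characteristic function is forced, at most one distribution has the Hermite FCGF.\<close>

lemma char_of_hermite_fcgf:
  assumes H: "real_distribution H"
    and fc: "has_fcgf H (\<lambda>x. x) (\<lambda>t. ereal (\<gamma> / 2 * t\<^sup>2 + \<mu> * t))"
  shows "char H u = hermite_pgf \<mu> \<gamma> (iexp u)"
proof -
  interpret real_distribution H by fact
  have "\<forall>\<^sub>F t in at_left 0. fcgf H (\<lambda>x. x) t = ereal (\<gamma> / 2 * t\<^sup>2 + \<mu> * t)"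
    using fc filter_leD[OF at_within_le_nhds] by (auto simp: has_fcgf_def)
  then have "\<forall>\<^sub>F t in at_left 0. \<exists>c. fcgf H (\<lambda>x. x) t = ereal c \<and>
      of_real (exp c) = hermite_pgf \<mu> \<gamma> (of_real (1 + t))"
    by eventually_elim (simp add: hermite_pgf_def flip: exp_of_real)
  then have "char (distr H borel (\<lambda>x. x)) u = hermite_pgf \<mu> \<gamma> (iexp u)"
    by (intro char_distr_of_fcgf prob_space_axioms)
       (auto simp: hermite_pgf_def[abs_def] intro!: holomorphic_intros continuous_intros)
  moreover have "distr H borel (\<lambda>x. x) = H"
    by (rule distr_id2) simp
  ultimately show ?thesis by simp
qed

lemma hermite_distr:
  assumes "0 \<le> \<gamma>" "\<gamma> \<le> \<mu>"
  shows "real_distribution (hermite_distr \<mu> \<gamma>)"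
    and "char (hermite_distr \<mu> \<gamma>) u = hermite_pgf \<mu> \<gamma> (iexp u)"
proof -
  let ?P = "\<lambda>H. real_distribution H \<and> has_fcgf H (\<lambda>x. x) (\<lambda>t. ereal (\<gamma> / 2 * t\<^sup>2 + \<mu> * t))"
  have "\<exists>!H. ?P H"
    using hermite_distribution_exists[OF assms] char_of_hermite_fcgf
    by (auto intro!: Levy_uniqueness ext)
  then have "?P (hermite_distr \<mu> \<gamma>)"
    unfolding hermite_distr_def by (rule theI')
  then show "real_distribution (hermite_distr \<mu> \<gamma>)"
    and "char (hermite_distr \<mu> \<gamma>) u = hermite_pgf \<mu> \<gamma> (iexp u)"
    using char_of_hermite_fcgf by auto
qed

section \<open>Probability generating functions on the closed unit disk\<close>

definition pgf :: "nat pmf \<Rightarrow> complex \<Rightarrow> complex" where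
  "pgf p w = (\<integral>k. w ^ k \<partial>measure_pmf p)"

lemma pgf_of_real: "pgf p (of_real s) = of_real (\<integral>k. s ^ k \<partial>measure_pmf p)"
  by (simp add: pgf_def flip: of_real_power integral_complex_of_real)

lemma integrable_power_pmf:
  fixes w :: "'b :: {real_normed_field, banach, second_countable_topology}"
  assumes "norm w \<le> 1"
  shows "integrable (measure_pmf p) (\<lambda>k. w ^ k)"
  using assms by (intro measure_pmf.integrable_const_bound[of _ 1])
    (auto simp: norm_power power_le_one)

lemma pgf_holomorphic: "pgf p holomorphic_on ball 0 1"
proof (rule power_series_holomorphic)
  fix w :: complex assume "w \<in> ball 0 1"
  then have "integrable (density (count_space UNIV) (pmf p)) (\<lambda>k. w ^ k)"
    using integrable_power_pmf[of w p] by (simp add: measure_pmf_eq_density)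
  then have "integrable (count_space UNIV) (\<lambda>k. pmf p k *\<^sub>R w ^ k)"
    by (simp add: integrable_density)
  from sums_integral_count_space_nat[OF this]
  show "(\<lambda>k. of_real (pmf p k) * (w - 0) ^ k) sums pgf p w"
    by (simp add: pgf_def measure_pmf_eq_density integral_density scaleR_conv_of_real)
qed

lemma pgf_continuous: "continuous_on (cball 0 1) (pgf p)"
  unfolding continuous_on_sequentially
proof (intro ballI allI impI, elim conjE)
  fix w and S :: "nat \<Rightarrow> complex"
  assume S: "\<forall>n. S n \<in> cball 0 1" "S \<longlonglongrightarrow> w"
  show "(pgf p \<circ> S) \<longlonglongrightarrow> pgf p w"
    unfolding pgf_def comp_def
    by (rule integral_dominated_convergence[where w = "\<lambda>_. 1"])
       (use S in \<open>auto intro!: tendsto_intros power_le_one simp: norm_power\<close>)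
qed

text \<open>
  The second-order Taylor remainder quotient of \<open>(1 + z)\<^sup>k\<close> at zero.  The recursion in \<open>k\<close> below
  gives both its limit and the bound by \<open>k\<^sup>2\<close> in the disk \<open>|1 + z| \<le> 1\<close>.
\<close>

definition taylor_quotient :: "nat \<Rightarrow> complex \<Rightarrow> complex" where
  "taylor_quotient k z = ((1 + z) ^ k - 1 - of_nat k * z) / z\<^sup>2"

lemma taylor_quotient_0: "taylor_quotient 0 z = 0"
  by (simp add: taylor_quotient_def)

lemma taylor_quotient_Suc:
  assumes "z \<noteq> 0"
  shows "taylor_quotient (Suc k) z = (1 + z) * taylor_quotient k z + of_nat k"
  using assms by (simp add: taylor_quotient_def field_simps power2_eq_square)

lemma norm_taylor_quotient_le:
  assumes "z \<noteq> 0" "norm (1 + z) \<le> 1"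
  shows "norm (taylor_quotient k z) \<le> (real k)\<^sup>2"
proof (induction k)
  case (Suc k)
  have "norm (taylor_quotient (Suc k) z) \<le> norm (1 + z) * norm (taylor_quotient k z) + real k"
    unfolding taylor_quotient_Suc[OF assms(1)] by (metis norm_mult norm_of_nat norm_triangle_ineq)
  also have "\<dots> \<le> 1 * (real k)\<^sup>2 + real k"
    using Suc assms by (intro add_mono mult_mono) auto
  also have "\<dots> \<le> (real (Suc k))\<^sup>2"
    by (simp add: power2_eq_square algebra_simps)
  finally show ?case .
qed (simp add: taylor_quotient_0)

lemma taylor_quotient_tendsto:
  "(taylor_quotient k \<longlongrightarrow> of_real (real k * (real k - 1) / 2)) (at 0)"
proof (induction k)
  case 0
  then show ?case by (simp add: taylor_quotient_0)
next
  case (Suc k)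
  have "((\<lambda>z. (1 + z) * taylor_quotient k z + of_nat k) \<longlongrightarrow>
      (1 + 0) * of_real (real k * (real k - 1) / 2) + of_nat k) (at 0)"
    by (intro tendsto_intros Suc)
  also have "(1 + 0) * complex_of_real (real k * (real k - 1) / 2) + of_nat k =
      of_real (real (Suc k) * (real (Suc k) - 1) / 2)"
    by (simp add: field_simps)
  finally show ?case
    by (rule Lim_transform_eventually) (auto simp: eventually_at_filter taylor_quotient_Suc)
qed

text \<open>
  The generating function need not extend beyond the unit disk, so the expansion at the boundary
  point \<open>1\<close> holds only within the closed disk.  It is the average of the expansions of \<open>(1 + z)\<^sup>k\<close>:
  the bound \<open>k\<^sup>2\<close> on the quotients is integrable by assumption, and dominated convergence applies.
\<close>

lemma pgf_second_order:
  fixes p :: "nat pmf"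
  assumes sq: "integrable (measure_pmf p) (\<lambda>k. (real k)\<^sup>2)"
  shows "((\<lambda>z. (pgf p (1 + z) - 1 - of_real (\<integral>k. real k \<partial>measure_pmf p) * z) / z\<^sup>2)
     \<longlongrightarrow> of_real ((\<integral>k. real k * (real k - 1) \<partial>measure_pmf p) / 2)) (at 0 within {z. norm (1 + z) \<le> 1})"
  unfolding tendsto_at_iff_sequentially
proof (intro allI impI)
  fix S :: "nat \<Rightarrow> complex"
  assume S: "\<forall>i. S i \<in> {z. norm (1 + z) \<le> 1} - {0}" "S \<longlonglongrightarrow> 0"
  have int1: "integrable (measure_pmf p) (\<lambda>k. real k)"
    by (rule measure_pmf.square_integrable_imp_integrable[OF _ sq]) simp
  have eq: "(pgf p (1 + z) - 1 - of_real (\<integral>k. real k \<partial>measure_pmf p) * z) / z\<^sup>2 =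
      (\<integral>k. taylor_quotient k z \<partial>measure_pmf p)" if "norm (1 + z) \<le> 1" for z
  proof -
    have int: "integrable (measure_pmf p) (\<lambda>k. (1 + z) ^ k)"
        "integrable (measure_pmf p) (\<lambda>k. complex_of_nat k)"
      using integrable_of_real[OF int1, where 'a = complex] by (auto intro: integrable_power_pmf that)
    then have "(\<integral>k. taylor_quotient k z \<partial>measure_pmf p) =
        ((\<integral>k. (1 + z) ^ k \<partial>measure_pmf p) - 1 - (\<integral>k. complex_of_nat k \<partial>measure_pmf p) * z) / z\<^sup>2"
      unfolding taylor_quotient_def by (simp add: integral_diff)
    then show ?thesis
      by (simp add: pgf_def flip: integral_complex_of_real)
  qed
  have "(\<lambda>i. \<integral>k. taylor_quotient k (S i) \<partial>measure_pmf p)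
      \<longlonglongrightarrow> (\<integral>k. complex_of_real (real k * (real k - 1) / 2) \<partial>measure_pmf p)"
  proof (rule integral_dominated_convergence[OF _ _ sq])
    have "filterlim S (at 0) sequentially"
      using S by (auto simp: filterlim_at)
    then show "AE k in measure_pmf p. (\<lambda>i. taylor_quotient k (S i))
        \<longlonglongrightarrow> complex_of_real (real k * (real k - 1) / 2)"
      by (intro AE_I2 filterlim_compose[OF taylor_quotient_tendsto])
  qed (use S(1) norm_taylor_quotient_le in auto)
  then show "((\<lambda>z. (pgf p (1 + z) - 1 - of_real (\<integral>k. real k \<partial>measure_pmf p) * z) / z\<^sup>2) \<circ> S)
     \<longlonglongrightarrow> of_real ((\<integral>k. real k * (real k - 1) \<partial>measure_pmf p) / 2)"
    unfolding integral_complex_of_real using S(1) by (simp add: comp_def eq)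
qed

section \<open>Limits of powers and of the standardized generating function\<close>

lemma exp_second_order:
  fixes m :: complex
  shows "((\<lambda>z. (exp (m * z) - 1 - m * z) / z\<^sup>2) \<longlongrightarrow> m\<^sup>2 / 2) (at 0)"
proof (rule LIM_zero_cancel, rule Lim_null_comparison)
  show "((\<lambda>z. exp (norm (m * z)) * norm m ^ 3 * norm z / 2) \<longlongrightarrow> 0) (at 0)"
    by (auto intro!: tendsto_eq_intros)
  have "norm ((exp (m * z) - 1 - m * z) / z\<^sup>2 - m\<^sup>2 / 2) \<le> exp (norm (m * z)) * norm m ^ 3 * norm z / 2"
    if "z \<noteq> 0" for z
  proof -
    have "(exp (m * z) - 1 - m * z) / z\<^sup>2 - m\<^sup>2 / 2 = (exp (m * z) - (\<Sum>i\<le>2. (m * z) ^ i / fact i)) / z\<^sup>2"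
      using that by (simp add: field_simps eval_nat_numeral)
    moreover have "norm ((exp (m * z) - (\<Sum>i\<le>2. (m * z) ^ i / fact i)) / z\<^sup>2)
        \<le> (exp (norm (m * z)) * norm (m * z) ^ Suc 2 / fact 2) / norm (z\<^sup>2)"
      unfolding norm_divide by (intro divide_right_mono Taylor_exp_field) simp
    moreover have "\<dots> = exp (norm (m * z)) * norm m ^ 3 * norm z / 2"
      using that by (simp add: norm_mult norm_power field_simps eval_nat_numeral)
    ultimately show ?thesis by simp
  qed
  then show "\<forall>\<^sub>F z in at 0. norm ((exp (m * z) - 1 - m * z) / z\<^sup>2 - m\<^sup>2 / 2)
      \<le> exp (norm (m * z)) * norm m ^ 3 * norm z / 2"
    by (auto simp: eventually_at_filter)
qed

text \<open>
  The complex form of \<open>(1 + a / n)\<^sup>n \<longlonglongrightarrow> e\<^sup>a\<close> with varying \<open>a\<close>.  Writing \<open>Ln x = g(x) (x - 1)\<close> with \<open>g\<close>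
  continuous at \<open>1\<close> and \<open>g(1) = 1\<close> gives \<open>n Ln (x n) = n (x n - 1) g(x n) \<longlonglongrightarrow> a\<close>.
\<close>

lemma tendsto_power_exp:
  fixes x :: "nat \<Rightarrow> complex"
  assumes lim: "(\<lambda>n. of_nat n * (x n - 1)) \<longlonglongrightarrow> a"
  shows "(\<lambda>n. x n ^ n) \<longlonglongrightarrow> exp a"
proof -
  have "(Ln has_field_derivative 1) (at 1)"
    using has_field_derivative_Ln[of 1] by simp
  then obtain g where g: "\<And>z. Ln z - Ln 1 = g z * (z - 1)" "isCont g 1" "g 1 = 1"
    by (auto simp: CARAT_DERIV)
  have "(\<lambda>n. of_nat n * (x n - 1) * (1 / of_nat n)) \<longlonglongrightarrow> a * 0"
    by (intro tendsto_mult lim lim_1_over_n)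
  also have "a * 0 = 0" by simp
  finally have "(\<lambda>n. x n - 1) \<longlonglongrightarrow> 0"
    by (rule Lim_transform_eventually)
       (use eventually_gt_at_top[of "0::nat"] in \<open>eventually_elim, simp\<close>)
  then have x: "x \<longlonglongrightarrow> 1"
    by (simp add: LIM_zero_iff)
  then have "(\<lambda>n. g (x n)) \<longlonglongrightarrow> 1"
    using isCont_tendsto_compose[OF g(2) x] g(3) by simp
  then have "(\<lambda>n. exp ((of_nat n * (x n - 1)) * g (x n))) \<longlonglongrightarrow> exp (a * 1)"
    by (intro tendsto_intros lim)
  moreover have "\<forall>\<^sub>F n in sequentially. x n \<noteq> 0"
    using x by (rule tendsto_imp_eventually_ne) simp
  then have "\<forall>\<^sub>F n in sequentially. exp ((of_nat n * (x n - 1)) * g (x n)) = x n ^ n"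
  proof eventually_elim
    case (elim n)
    have Ln: "(of_nat n * (x n - 1)) * g (x n) = of_nat n * Ln (x n)"
      using g(1)[of "x n"] by (simp add: mult_ac)
    show ?case
      unfolding Ln exp_of_nat_mult using elim by simp
  qed
  ultimately show ?thesis
    by (simp add: Lim_transform_eventually)
qed

text \<open>
  The exponential of the FCGF of \<open>Z\<^sub>n(\<mu>)\<close>, written in \<open>w = 1 + t\<close> and continued to the closed disk.
\<close>

definition standardized_pgf :: "nat pmf \<Rightarrow> real \<Rightarrow> real \<Rightarrow> nat \<Rightarrow> complex \<Rightarrow> complex" where
  "standardized_pgf p m \<mu> n w =
     pgf p (1 + (w - 1) / of_real (sqrt n)) ^ n *
     exp (- of_real (sqrt n * m - \<mu>) * (w - 1))"

text \<open>The point \<open>1 + (w - 1) / s\<close> is a convex combination of \<open>1\<close> and \<open>w\<close>.\<close>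

lemma affine_to_one_in_disk:
  fixes w :: complex
  assumes "s \<ge> 1"
  shows "norm w \<le> 1 \<Longrightarrow> norm (1 + (w - 1) / of_real s) \<le> 1"
    and "norm w < 1 \<Longrightarrow> norm (1 + (w - 1) / of_real s) < 1"
proof -
  have "1 + (w - 1) / of_real s = of_real (1 - 1 / s) + w / of_real s"
    by (simp add: diff_divide_distrib)
  then have "norm (1 + (w - 1) / of_real s) \<le> norm (complex_of_real (1 - 1 / s)) + norm (w / of_real s)"
    by (metis norm_triangle_ineq)
  also have "\<dots> = 1 - 1 / s + norm w / s"
    using assms by (simp add: norm_divide norm_of_real del: of_real_diff of_real_divide)
  finally have *: "norm (1 + (w - 1) / of_real s) \<le> 1 - 1 / s + norm w / s" .
  show "norm (1 + (w - 1) / of_real s) \<le> 1" if "norm w \<le> 1"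
    using that assms by (intro order_trans[OF *]) (simp add: field_simps)
  show "norm (1 + (w - 1) / of_real s) < 1" if "norm w < 1"
    using that assms by (intro le_less_trans[OF *]) (simp add: field_simps)
qed

lemma standardized_pgf_regular:
  assumes "n \<ge> 1"
  shows "standardized_pgf p m \<mu> n holomorphic_on ball 0 1"
    and "continuous_on (cball 0 1) (standardized_pgf p m \<mu> n)"
proof -
  have n: "sqrt n \<ge> 1" "sqrt n \<noteq> 0" using assms by auto
  let ?A = "\<lambda>w :: complex. 1 + (w - 1) / of_real (sqrt n)"
  have A: "?A holomorphic_on ball 0 1" "continuous_on (cball 0 1) ?A"
    using n by (auto intro!: holomorphic_intros continuous_intros)
  have A_image: "?A ` ball 0 1 \<subseteq> ball 0 1" "?A ` cball 0 1 \<subseteq> cball 0 1"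
    using affine_to_one_in_disk[OF n(1)] by auto
  have "(\<lambda>w. pgf p (?A w)) holomorphic_on ball 0 1"
    using holomorphic_on_compose_gen[OF A(1) pgf_holomorphic A_image(1)] by (simp add: comp_def)
  then show "standardized_pgf p m \<mu> n holomorphic_on ball 0 1"
    unfolding standardized_pgf_def[abs_def] by (intro holomorphic_intros)
  have "continuous_on (cball 0 1) (\<lambda>w. pgf p (?A w))"
    using continuous_on_compose2[OF pgf_continuous A(2) A_image(2)] .
  then show "continuous_on (cball 0 1) (standardized_pgf p m \<mu> n)"
    unfolding standardized_pgf_def[abs_def] by (intro continuous_intros)
qed

text \<open>
  With \<open>z = w - 1\<close> and \<open>v = z / \<surd>n\<close>, the standardized generating function is \<open>\<psi>(v)\<^sup>n e\<^sup>\<mu>\<^sup>z\<close>, where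
  \<open>\<psi>(v) = G(1 + v) e\<^sup>-\<^sup>m\<^sup>v\<close>.  The factor \<open>e\<^sup>-\<^sup>m\<^sup>v\<close> removes the linear term of \<open>G\<close>, so
  \<open>\<psi>(v) = 1 + \<gamma> v\<^sup>2 / 2 + o(v\<^sup>2)\<close> and \<open>n (\<psi>(v) - 1) \<longlonglongrightarrow> \<gamma> z\<^sup>2 / 2\<close>.
\<close>

lemma standardized_pgf_tendsto:
  fixes p :: "nat pmf" and \<mu> :: real
  defines "m \<equiv> (\<integral>k. real k \<partial>measure_pmf p)"
  defines "\<gamma> \<equiv> (\<integral>k. real k * (real k - 1) \<partial>measure_pmf p) - m\<^sup>2"
  assumes sq: "integrable (measure_pmf p) (\<lambda>k. (real k)\<^sup>2)" and w: "norm w \<le> 1"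
  shows "(\<lambda>n. standardized_pgf p m \<mu> n w) \<longlonglongrightarrow> hermite_pgf \<mu> \<gamma> w"
proof (cases "w = 1")
  case True
  then show ?thesis by (simp add: standardized_pgf_def hermite_pgf_def pgf_def)
next
  case False
  define z where "z = w - 1"
  define \<psi> where "\<psi> v = pgf p (1 + v) * exp (- of_real m * v)" for v
  define v where "v n = z / of_real (sqrt n)" for n :: nat
  have z: "z \<noteq> 0" using False by (simp add: z_def)
  let ?D = "at 0 within {v :: complex. norm (1 + v) \<le> 1}"
  have psi_limit: "((\<lambda>v. (\<psi> v - 1) / v\<^sup>2) \<longlongrightarrow> of_real (\<gamma> / 2)) ?D"
  proof -
    have exp2: "((\<lambda>v. (exp (of_real m * v) - 1 - of_real m * v) / v\<^sup>2) \<longlongrightarrow> (of_real m)\<^sup>2 / 2) ?D"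
      by (rule filterlim_mono[OF exp_second_order order_refl at_le]) simp
    \<comment> \<open>\<open>\<psi>(v) - 1 = e\<^sup>-\<^sup>m\<^sup>v (G(1 + v) - e\<^sup>m\<^sup>v)\<close>: the affine parts of \<open>G(1 + v)\<close> and \<open>e\<^sup>m\<^sup>v\<close> cancel.\<close>
    have "((\<lambda>v. exp (- of_real m * v) *
          ((pgf p (1 + v) - 1 - of_real m * v) / v\<^sup>2 - (exp (of_real m * v) - 1 - of_real m * v) / v\<^sup>2))
        \<longlongrightarrow> exp (- of_real m * 0) *
          (of_real ((\<integral>k. real k * (real k - 1) \<partial>measure_pmf p) / 2) - (of_real m)\<^sup>2 / 2)) ?D"
      by (intro tendsto_intros exp2 pgf_second_order[OF sq, folded m_def])
    also have "exp (- of_real m * 0) *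
          (of_real ((\<integral>k. real k * (real k - 1) \<partial>measure_pmf p) / 2) - (of_real m)\<^sup>2 / 2)
        = complex_of_real (\<gamma> / 2)"
      by (simp add: \<gamma>_def diff_divide_distrib)
    also have "(\<lambda>v. exp (- of_real m * v) *
          ((pgf p (1 + v) - 1 - of_real m * v) / v\<^sup>2 - (exp (of_real m * v) - 1 - of_real m * v) / v\<^sup>2))
        = (\<lambda>v. (\<psi> v - 1) / v\<^sup>2)"
      by (simp add: \<psi>_def exp_minus fun_eq_iff field_simps flip: diff_divide_distrib)
    finally show ?thesis .
  qed
  have disk: "norm (1 + v n) \<le> 1" if "n \<ge> 1" for n
    using affine_to_one_in_disk(1)[of "sqrt n" w] that w by (simp add: v_def z_def)
  have "(\<lambda>n. z * of_real (1 / sqrt n)) \<longlonglongrightarrow> z * of_real 0"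
    by (intro tendsto_intros) real_asymp
  then have "v \<longlonglongrightarrow> 0"
    by (simp add: v_def[abs_def])
  moreover have "\<forall>\<^sub>F n in sequentially. v n \<in> {v. norm (1 + v) \<le> 1} \<and> v n \<noteq> 0"
    using eventually_ge_at_top[of 1] by eventually_elim (use disk z in \<open>auto simp: v_def\<close>)
  ultimately have "filterlim v ?D sequentially"
    by (simp add: filterlim_at)
  from filterlim_compose[OF psi_limit this]
  have "(\<lambda>n. z\<^sup>2 * ((\<psi> (v n) - 1) / (v n)\<^sup>2)) \<longlonglongrightarrow> z\<^sup>2 * of_real (\<gamma> / 2)"
    by (rule tendsto_mult_left)
  then have "(\<lambda>n. of_nat n * (\<psi> (v n) - 1)) \<longlonglongrightarrow> z\<^sup>2 * of_real (\<gamma> / 2)"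
  proof (rule Lim_transform_eventually)
    have sq: "(complex_of_real (sqrt n))\<^sup>2 = of_nat n" for n
      by (simp flip: of_real_power)
    show "\<forall>\<^sub>F n in sequentially. z\<^sup>2 * ((\<psi> (v n) - 1) / (v n)\<^sup>2) = of_nat n * (\<psi> (v n) - 1)"
      using eventually_ge_at_top[of 1]
      by eventually_elim (use z in \<open>simp add: v_def power_divide sq\<close>)
  qed
  from tendsto_mult[OF tendsto_power_exp[OF this] tendsto_const[of "exp (of_real \<mu> * z)"]]
  have "(\<lambda>n. \<psi> (v n) ^ n * exp (of_real \<mu> * z)) \<longlonglongrightarrow> hermite_pgf \<mu> \<gamma> w"
    by (simp add: hermite_pgf_def z_def exp_add mult_ac)
  then show ?thesis
  proof (rule Lim_transform_eventually)
    have "\<psi> (v n) ^ n * exp (of_real \<mu> * z) = standardized_pgf p m \<mu> n w" if "n \<ge> 1" for n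
    proof -
      have n_eq: "of_nat n = complex_of_real (sqrt n) * of_real (sqrt n)"
        by (simp flip: of_real_mult)
      have "complex_of_real (sqrt n) \<noteq> 0"
        using that by simp
      then have exponent: "of_nat n * (- of_real m * v n) = - of_real (sqrt n * m) * z"
        unfolding v_def n_eq by simp
      have "exp (- of_real m * v n) ^ n * exp (of_real \<mu> * z) = exp (- of_real (sqrt n * m - \<mu>) * z)"
        unfolding exp_of_nat_mult[symmetric] exponent exp_add[symmetric] by (simp add: algebra_simps)
      then show ?thesis
        by (simp add: \<psi>_def standardized_pgf_def v_def z_def power_mult_distrib mult.assoc)
    qed
    then show "\<forall>\<^sub>F n in sequentially. \<psi> (v n) ^ n * exp (of_real \<mu> * z) = standardized_pgf p m \<mu> n w"
      by (rule eventually_at_top_linorderI)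
  qed
qed

section \<open>The factorial cumulants of the standardized sum\<close>

lemma (in prob_space) nn_integral_powr_sum_iid:
  fixes X :: "nat \<Rightarrow> 'a \<Rightarrow> nat"
  assumes indep: "indep_vars (\<lambda>_. count_space UNIV) X {1..}"
    and distr: "\<And>i. i \<ge> 1 \<Longrightarrow> distr M (count_space UNIV) (X i) = measure_pmf p"
    and s: "0 < s" "s \<le> 1"
  shows "(\<integral>\<^sup>+ \<omega>. ennreal (s powr (\<Sum>i=1..n. real (X i \<omega>))) \<partial>M) =
    ennreal ((\<integral>k. s ^ k \<partial>measure_pmf p) ^ n)"
proof -
  have X[measurable]: "X i \<in> measurable M (count_space UNIV)" if "i \<ge> 1" for i
    using indep that by (auto simp: indep_vars_def)
  have single: "(\<integral>\<^sup>+ \<omega>. ennreal (s ^ X i \<omega>) \<partial>M) = ennreal (\<integral>k. s ^ k \<partial>measure_pmf p)" if "i \<ge> 1" for i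
  proof -
    have "(\<integral>\<^sup>+ \<omega>. ennreal (s ^ X i \<omega>) \<partial>M) = (\<integral>\<^sup>+ k. ennreal (s ^ k) \<partial>distr M (count_space UNIV) (X i))"
      using that by (subst nn_integral_distr) auto
    also have "\<dots> = ennreal (\<integral>k. s ^ k \<partial>measure_pmf p)"
      unfolding distr[OF that] using s by (intro nn_integral_eq_integral integrable_power_pmf) auto
    finally show ?thesis .
  qed
  have "s powr (\<Sum>i=1..n. real (X i \<omega>)) = (\<Prod>i=1..n. s ^ X i \<omega>)" for \<omega>
    using s by (simp add: powr_realpow power_sum flip: of_nat_sum)
  then have "(\<integral>\<^sup>+ \<omega>. ennreal (s powr (\<Sum>i=1..n. real (X i \<omega>))) \<partial>M) =
      (\<integral>\<^sup>+ \<omega>. (\<Prod>i=1..n. ennreal (s ^ X i \<omega>)) \<partial>M)"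
    using s by (simp add: prod_ennreal)
  also have "\<dots> = (\<Prod>i=1..n. \<integral>\<^sup>+ \<omega>. ennreal (s ^ X i \<omega>) \<partial>M)"
  proof (rule indep_vars_nn_integral)
    show "indep_vars (\<lambda>_. borel) (\<lambda>i \<omega>. ennreal (s ^ X i \<omega>)) {1..n}"
      by (rule indep_vars_compose2[OF indep_vars_subset[OF indep]]) auto
  qed auto
  also have "\<dots> = ennreal ((\<integral>k. s ^ k \<partial>measure_pmf p) ^ n)"
    using s by (simp add: single ennreal_power)
  finally show ?thesis .
qed

lemma expectation_power_pmf_pos:
  fixes s :: real
  assumes "0 < s" "s \<le> 1"
  shows "(\<integral>k. s ^ k \<partial>measure_pmf p) > 0"
  using assms measure_pmf.integral_less_AE_space[of p "\<lambda>_. 0" "\<lambda>k. s ^ k"]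
    measure_pmf.emeasure_space_1[of p] integrable_power_pmf[of s p]
  by simp

text \<open>
  The generating function is used only at \<open>1 + t / \<surd>n \<le> 1\<close>, where it is finite; this is why \<open>t\<close> is
  negative.
\<close>

lemma standardized_fcgf:
  fixes p :: "nat pmf" and m \<mu> :: real
  assumes n: "n \<ge> 1"
    and C: "\<And>t. -1 < t \<Longrightarrow> t < 0 \<Longrightarrow> C t = ereal (ln ((\<integral>k. (1 + t) ^ k \<partial>measure_pmf p) ^ n))"
    and t: "-1 < t" "t < 0"
  shows "\<exists>c. fcgf_dilate (1 / sqrt n) (fcgf_poisson_minus C (real n * m - sqrt n * \<mu>)) t = ereal c \<and>
      of_real (exp c) = standardized_pgf p m \<mu> n (of_real (1 + t))"
proof -
  define g where "g = (\<integral>k. (1 + t / sqrt n) ^ k \<partial>measure_pmf p)"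
  have n': "sqrt n \<ge> 1" using n by simp
  have "t \<le> t / sqrt n" using n' t by (simp add: field_simps)
  then have range: "-1 < t / sqrt n" "t / sqrt n < 0"
    using t n by (auto simp: divide_neg_pos)
  have g: "g > 0"
    unfolding g_def using range by (intro expectation_power_pmf_pos) auto
  have mean_shift: "(real n * m - sqrt n * \<mu>) * (t / sqrt n) = (sqrt n * m - \<mu>) * t"
  proof -
    have "(sqrt n * sqrt n * m - sqrt n * \<mu>) * (t / sqrt n) = (sqrt n * m - \<mu>) * t"
      using n' by (simp add: field_simps del: real_sqrt_mult_self)
    then show ?thesis by simp
  qed
  have "fcgf_dilate (1 / sqrt n) (fcgf_poisson_minus C (real n * m - sqrt n * \<mu>)) t
      = ereal (ln (g ^ n) - (sqrt n * m - \<mu>) * t)"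
    using C[OF range] mean_shift by (simp add: fcgf_dilate_def fcgf_poisson_minus_def g_def)
  moreover have "of_real (exp (ln (g ^ n) - (sqrt n * m - \<mu>) * t)) =
      standardized_pgf p m \<mu> n (of_real (1 + t))"
  proof -
    have "standardized_pgf p m \<mu> n (of_real (1 + t)) =
        pgf p (of_real (1 + t / sqrt n)) ^ n * of_real (exp (- (sqrt n * m - \<mu>) * t))"
      unfolding standardized_pgf_def exp_of_real[symmetric] by simp
    also have "\<dots> = of_real (g ^ n * exp (- (sqrt n * m - \<mu>) * t))"
      unfolding pgf_of_real g_def by simp
    also have "g ^ n * exp (- (sqrt n * m - \<mu>) * t) = exp (ln (g ^ n) - (sqrt n * m - \<mu>) * t)"
      using g by (simp only: diff_conv_add_uminus exp_add minus_mult_left) simp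
    finally show ?thesis by simp
  qed
  ultimately show ?thesis by blast
qed

section \<open>Convergence to the Hermite distribution\<close>

theorem proposition2p4:
  fixes M :: "'a measure"
    and X :: "nat \<Rightarrow> 'a \<Rightarrow> nat"
    and S :: "nat \<Rightarrow> 'a \<Rightarrow> real"
    and N :: "nat \<Rightarrow> 'b measure"
    and Z :: "nat \<Rightarrow> 'b \<Rightarrow> real"
    and m \<gamma> \<mu> :: real
  assumes "prob_space M"
    and indep: "prob_space.indep_vars M (\<lambda>_. count_space UNIV) X {1..}"
    and ident: "\<And>i. i \<ge> 1 \<Longrightarrow>
      distr M (count_space UNIV) (X i) = distr M (count_space UNIV) (X 1)"
    and square_integrable: "integrable M (\<lambda>\<omega>. (real (X 1 \<omega>))\<^sup>2)"
    and mean: "prob_space.expectation M (\<lambda>\<omega>. real (X 1 \<omega>)) = m" "m > 0"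
    and disp: "dispersion M (\<lambda>\<omega>. real (X 1 \<omega>)) = \<gamma>" "\<gamma> > 0"
    and "\<mu> \<ge> \<gamma>"
  defines "S \<equiv> \<lambda>n \<omega>. \<Sum>i=1..n. real (X i \<omega>)"
  assumes N: "\<And>n. prob_space (N n)"
    and Z_meas: "\<And>n. Z n \<in> borel_measurable (N n)"
    and Z_fcgf: "\<forall>\<^sub>F n in sequentially.
      has_fcgf (N n) (Z n)
        (fcgf_dilate (1 / sqrt (real n))
          (fcgf_poisson_minus (fcgf M (S n)) (real n * m - sqrt (real n) * \<mu>)))"
  shows "weak_conv_m (\<lambda>n. distr (N n) borel (Z n)) (hermite_distr \<mu> \<gamma>)"
proof -
  interpret prob_space M by fact
  have X1[measurable]: "X 1 \<in> measurable M (count_space UNIV)"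
    using indep unfolding indep_vars_def by blast
  obtain p where p: "distr M (count_space UNIV) (X 1) = measure_pmf p"
    using nat_rv_pmf[OF X1] .
  have p_all: "distr M (count_space UNIV) (X i) = measure_pmf p" if "i \<ge> 1" for i
    using ident[OF that] p by (rule trans)
  have expect: "(\<integral>k. f k \<partial>measure_pmf p) = expectation (\<lambda>\<omega>. f (X 1 \<omega>))" for f :: "nat \<Rightarrow> real"
    unfolding p[symmetric] by (rule integral_distr[OF X1]) simp
  have sq: "integrable (measure_pmf p) (\<lambda>k. (real k)\<^sup>2)"
    unfolding p[symmetric] using square_integrable by (subst integrable_distr_eq[OF X1]) simp_all
  have int1: "integrable M (\<lambda>\<omega>. real (X 1 \<omega>))"
    using X1 by (intro square_integrable_imp_integrable[OF _ square_integrable]) measurable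
  have m_eq: "(\<integral>k. real k \<partial>measure_pmf p) = m"
    using mean(1) by (simp add: expect)
  \<comment> \<open>The second factorial moment minus \<open>m\<^sup>2\<close> is \<open>Var(X) - E(X)\<close>, the dispersion.\<close>
  have "(\<integral>k. real k * (real k - 1) \<partial>measure_pmf p) = expectation (\<lambda>\<omega>. (real (X 1 \<omega>))\<^sup>2) - m"
    using int1 square_integrable mean(1) unfolding expect
    by (simp add: right_diff_distrib flip: power2_eq_square)
  then have \<gamma>_eq: "(\<integral>k. real k * (real k - 1) \<partial>measure_pmf p) - m\<^sup>2 = \<gamma>"
    using disp(1) mean(1) variance_eq[OF int1 square_integrable] by (simp add: dispersion_def)
  have fcgf_S: "fcgf M (S n) t = ereal (ln ((\<integral>k. (1 + t) ^ k \<partial>measure_pmf p) ^ n))"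
    if "-1 < t" "t < 0" for n t
  proof (rule fcgf_eqI)
    show "(\<integral>\<^sup>+ \<omega>. ennreal ((1 + t) powr S n \<omega>) \<partial>M) = ennreal ((\<integral>k. (1 + t) ^ k \<partial>measure_pmf p) ^ n)"
      unfolding S_def using that by (intro nn_integral_powr_sum_iid[OF indep p_all]) auto
    show "0 \<le> (\<integral>k. (1 + t) ^ k \<partial>measure_pmf p) ^ n"
      using that by simp
  qed
  have char_Z: "\<forall>\<^sub>F n in sequentially. standardized_pgf p m \<mu> n (iexp u) = char (distr (N n) borel (Z n)) u" for u
    using Z_fcgf eventually_ge_at_top[of 1]
  proof eventually_elim
    case (elim n)
    have "\<forall>\<^sub>F t in at_left 0. fcgf (N n) (Z n) t = fcgf_dilate (1 / sqrt (real n))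
          (fcgf_poisson_minus (fcgf M (S n)) (real n * m - sqrt (real n) * \<mu>)) t"
      using elim(1) filter_leD[OF at_within_le_nhds] by (auto simp: has_fcgf_def)
    moreover have "\<forall>\<^sub>F t in at_left (0::real). t \<in> {-1<..<0}"
      by (intro eventually_at_leftI[of "-1"]) auto
    ultimately have "\<forall>\<^sub>F t in at_left 0. \<exists>c. fcgf (N n) (Z n) t = ereal c \<and>
        of_real (exp c) = standardized_pgf p m \<mu> n (of_real (1 + t))"
      by eventually_elim (use standardized_fcgf[OF elim(2) fcgf_S] in auto)
    then show ?case
      using char_distr_of_fcgf[OF N Z_meas _ standardized_pgf_regular[OF elim(2)]] by simp
  qed
  show ?thesis
  proof (rule levy_continuity)
    show "real_distribution (distr (N n) borel (Z n))" for n
      using prob_space.real_distribution_distr[OF N Z_meas] .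
    show "real_distribution (hermite_distr \<mu> \<gamma>)"
      using \<open>\<mu> \<ge> \<gamma>\<close> disp(2) by (intro hermite_distr) auto
    show "(\<lambda>n. char (distr (N n) borel (Z n)) u) \<longlonglongrightarrow> char (hermite_distr \<mu> \<gamma>) u" for u
    proof -
      have "(\<lambda>n. standardized_pgf p m \<mu> n (iexp u)) \<longlonglongrightarrow> hermite_pgf \<mu> \<gamma> (iexp u)"
        using standardized_pgf_tendsto[OF sq, of "iexp u" \<mu>] by (simp add: m_eq \<gamma>_eq)
      then have "(\<lambda>n. char (distr (N n) borel (Z n)) u) \<longlonglongrightarrow> hermite_pgf \<mu> \<gamma> (iexp u)"
        using char_Z by (rule Lim_transform_eventually)
      then show ?thesis
        using \<open>\<mu> \<ge> \<gamma>\<close> disp(2) by (simp add: hermite_distr(2))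
    qed
  qed
qed

end
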